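(* Let $L>0$ and let $\omega:\mathbb N\to[1,\infty)$ be any nondecreasing function with $\omega(N)\to\infty$ as $N\to\infty$. There exist a nonadaptive horizon-independent linear-span method $\mathcal A$ and a set of horizons $S\subset\mathbb N$ with lower asymptotic density $\underline d(S)=1$ such that $$\mathcal G_N(\mathcal A)\le\frac{\omega(N)}{N^2}\qquad\text{for all }N\in S.$$
   Context: Fix $L>0$; $\mathbb N=\{1,2,\ldots\}$. $\mathcal F_{0,L}(\mathbb R^d)$ is the class of convex differentiable functions $f:\mathbb R^d\to\mathbb R$ that admit a minimizer and whose gradient is $L$-Lipschitz (Euclidean norm); $f_\star:=\min f$. A nonadaptive horizon-independent linear-span method $\mathcal A$ is given by a single infinite array of real coefficients $(\beta_{i,k})_{0\le i<k}$, fixed in advance (independent of $f$, of $x_0$, of the dimension, of all observed gradients, and of any stopping horizon). Applied to $f$ and $x_0$ it generates $x_k=x_0-\frac1L\sum_{i=0}^{k-1}\beta_{i,k}\nabla f(x_i)$, $k\ge1$. Its worst-case bound after $N$ iterations is $$\mathcal G_N(\mathcal A):=\sup_{d\ge1,\ f\in\mathcal F_{0,L}(\mathbb R^d),\ x_0\in\mathbb R^d,\ f(x_0)>f_\star}\frac{\|\nabla f(x_N)\|^2}{L(f(x_0)-f_\star)}.$$ For $S\subset\mathbb N$, $\underline d(S):=\liminf_{M\to\infty}|S\cap\{1,\ldots,M\}|/M$. *)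

theory Defs
  imports "HOL-Analysis.Analysis"
begin

text \<open>
  The dimension \<open>d\<close> has to range over all positive integers inside one supremum, so the spaces
  \<open>R^d\<close> cannot be separate types.  They are realised as the coordinate subspaces \<open>Rn d\<close>
  (coordinates \<open>0, ..., d - 1\<close>) of the inner product space of finitely supported real sequences;
  on \<open>Rn d\<close> the inner product and norm are the Euclidean ones (\<open>inner_Rn\<close>, \<open>norm_Rn\<close> below).
\<close>

typedef fin_seq = "{x :: nat \<Rightarrow> real. finite {i. x i \<noteq> 0}}"
  morphisms coord Abs_fin_seq
  by (rule exI[of _ "\<lambda>_. 0"]) simp

setup_lifting type_definition_fin_seq

lemma finite_support [simp]: "finite {i. coord x i \<noteq> 0}"
  using coord[of x] by simp

lemma fin_seq_eq_iff: "x = y \<longleftrightarrow> (\<forall>i. coord x i = coord y i)"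
  by transfer auto

instantiation fin_seq :: real_vector
begin

lift_definition zero_fin_seq :: fin_seq is "\<lambda>_. 0" by simp

lift_definition plus_fin_seq :: "fin_seq \<Rightarrow> fin_seq \<Rightarrow> fin_seq" is "\<lambda>x y i. x i + y i"
  by (erule (1) finite_subset[OF _ finite_UnI, rotated]) auto

lift_definition minus_fin_seq :: "fin_seq \<Rightarrow> fin_seq \<Rightarrow> fin_seq" is "\<lambda>x y i. x i - y i"
  by (erule (1) finite_subset[OF _ finite_UnI, rotated]) auto

lift_definition uminus_fin_seq :: "fin_seq \<Rightarrow> fin_seq" is "\<lambda>x i. - x i" by simp

lift_definition scaleR_fin_seq :: "real \<Rightarrow> fin_seq \<Rightarrow> fin_seq" is "\<lambda>c x i. c * x i"
  by (rule finite_subset) auto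

instance
  by standard (transfer, auto simp: algebra_simps)+

end

lemma coord_simps [simp]:
  "coord 0 i = 0"
  "coord (x + y) i = coord x i + coord y i"
  "coord (x - y) i = coord x i - coord y i"
  "coord (- x) i = - coord x i"
  "coord (c *\<^sub>R x) i = c * coord x i"
  by (transfer, simp)+

lemma coord_sum [simp]: "coord (\<Sum>j\<in>A. x j) i = (\<Sum>j\<in>A. coord (x j) i)"
  by (induction A rule: infinite_finite_induct) auto

instantiation fin_seq :: real_normed_vector
begin

definition norm_fin_seq :: "fin_seq \<Rightarrow> real" where
  "norm_fin_seq x = L2_set (coord x) {i. coord x i \<noteq> 0}"

definition dist_fin_seq :: "fin_seq \<Rightarrow> fin_seq \<Rightarrow> real" where
  "dist_fin_seq x y = norm (x - y)"

definition sgn_fin_seq :: "fin_seq \<Rightarrow> fin_seq" where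
  "sgn_fin_seq x = x /\<^sub>R norm x"

definition uniformity_fin_seq :: "(fin_seq \<times> fin_seq) filter" where
  "uniformity_fin_seq = (INF e\<in>{0<..}. principal {(x, y). dist x y < e})"

definition open_fin_seq :: "fin_seq set \<Rightarrow> bool" where
  "open_fin_seq U \<longleftrightarrow> (\<forall>x\<in>U. \<forall>\<^sub>F (x', y) in uniformity. x' = x \<longrightarrow> y \<in> U)"

lemma norm_superset:
  assumes "finite A" "{i. coord x i \<noteq> 0} \<subseteq> A"
  shows "norm x = L2_set (coord x) A"
  unfolding norm_fin_seq_def L2_set_def
  by (intro arg_cong[where f = sqrt] sum.mono_neutral_left) (use assms in auto)

instance
proof
  fix x y :: fin_seq and r :: real
  define A where "A = {i. coord x i \<noteq> 0} \<union> {i. coord y i \<noteq> 0}"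
  have fin: "finite A" by (simp add: A_def)
  note ex = norm_superset[OF fin]
  show "norm x = 0 \<longleftrightarrow> x = 0"
    by (auto simp: norm_fin_seq_def L2_set_eq_0_iff fin_seq_eq_iff)
  have "norm (x + y) = L2_set (\<lambda>i. coord x i + coord y i) A"
    by (subst ex) (auto simp: A_def L2_set_def)
  also have "\<dots> \<le> L2_set (coord x) A + L2_set (coord y) A"
    by (rule L2_set_triangle_ineq)
  also have "\<dots> = norm x + norm y"
    using ex[of x] ex[of y] by (simp add: A_def le_supI1)
  finally show "norm (x + y) \<le> norm x + norm y" .
  have "norm (r *\<^sub>R x) = L2_set (\<lambda>i. r * coord x i) A"
    by (subst ex) (auto simp: A_def L2_set_def)
  also have "\<dots> = \<bar>r\<bar> * L2_set (coord x) A"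
    by (simp add: L2_set_def power_mult_distrib real_sqrt_mult flip: sum_distrib_left)
  also have "L2_set (coord x) A = norm x"
    using ex[of x] by (simp add: A_def le_supI1)
  finally show "norm (r *\<^sub>R x) = \<bar>r\<bar> * norm x" .
qed (simp_all add: dist_fin_seq_def sgn_fin_seq_def uniformity_fin_seq_def open_fin_seq_def)

end

instantiation fin_seq :: real_inner
begin

definition inner_fin_seq :: "fin_seq \<Rightarrow> fin_seq \<Rightarrow> real" where
  "inner x y = (\<Sum>i | coord x i \<noteq> 0. coord x i * coord y i)"

lemma inner_superset:
  assumes "finite A" "{i. coord x i \<noteq> 0} \<subseteq> A"
  shows "inner x y = (\<Sum>i\<in>A. coord x i * coord y i)"
  unfolding inner_fin_seq_def by (rule sum.mono_neutral_left) (use assms in auto)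

instance
proof
  fix x y z :: fin_seq and r :: real
  define A where "A = {i. coord x i \<noteq> 0} \<union> {i. coord y i \<noteq> 0} \<union> {i. coord z i \<noteq> 0}"
  have fin: "finite A" by (simp add: A_def)
  note ex = inner_superset[OF fin]
  have sub: "{i. coord x i \<noteq> 0} \<subseteq> A" "{i. coord y i \<noteq> 0} \<subseteq> A"
    by (auto simp: A_def)
  show "inner x y = inner y x"
    by (simp add: ex sub mult.commute)
  have "inner (x + y) z = (\<Sum>i\<in>A. coord (x + y) i * coord z i)"
    by (rule ex) (auto simp: A_def)
  moreover have "inner x z = (\<Sum>i\<in>A. coord x i * coord z i)" "inner y z = (\<Sum>i\<in>A. coord y i * coord z i)"
    by (rule ex; auto simp: A_def)+
  ultimately show "inner (x + y) z = inner x z + inner y z"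
    by (simp add: distrib_right sum.distrib)
  have "inner (r *\<^sub>R x) y = (\<Sum>i\<in>A. coord (r *\<^sub>R x) i * coord y i)"
    by (rule ex) (auto simp: A_def)
  moreover have "inner x y = (\<Sum>i\<in>A. coord x i * coord y i)"
    by (rule ex) (auto simp: A_def)
  ultimately show "inner (r *\<^sub>R x) y = r * inner x y"
    by (simp add: sum_distrib_left mult.assoc)
  show "0 \<le> inner x x"
    by (simp add: inner_fin_seq_def sum_nonneg)
  show "inner x x = 0 \<longleftrightarrow> x = 0"
    by (auto simp: inner_fin_seq_def sum_nonneg_eq_0_iff fin_seq_eq_iff)
  show "norm x = sqrt (inner x x)"
    by (simp add: norm_fin_seq_def inner_fin_seq_def L2_set_def power2_eq_square)
qed

end

definition Rn :: "nat \<Rightarrow> fin_seq set" where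
  "Rn d = {x. \<forall>i\<ge>d. coord x i = 0}"

lemma subspace_Rn: "subspace (Rn d)"
  by (auto simp: subspace_def Rn_def)

lemma inner_Rn:
  assumes "x \<in> Rn d"
  shows "inner x y = (\<Sum>i<d. coord x i * coord y i)"
proof (rule inner_superset)
  show "{i. coord x i \<noteq> 0} \<subseteq> {..<d}"
  proof
    fix i assume "i \<in> {i. coord x i \<noteq> 0}"
    then have "\<not> d \<le> i" using assms by (auto simp: Rn_def)
    then show "i \<in> {..<d}" by simp
  qed
qed simp

lemma norm_Rn: "x \<in> Rn d \<Longrightarrow> norm x = L2_set (coord x) {..<d}"
  by (simp add: norm_eq_sqrt_inner inner_Rn L2_set_def power2_eq_square)

lemma Rn_ex1_coord: "\<exists>!x. x \<in> Rn d \<and> (\<forall>i<d. coord x i = a i)"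
proof -
  have "finite {i. (if i < d then a i else 0) \<noteq> 0}"
    by (rule finite_subset[of _ "{..<d}"]) auto
  then have "coord (Abs_fin_seq (\<lambda>i. if i < d then a i else 0)) = (\<lambda>i. if i < d then a i else 0)"
    by (simp add: Abs_fin_seq_inverse)
  then have *: "\<exists>x. x \<in> Rn d \<and> (\<forall>i<d. coord x i = a i)"
    by (intro exI[of _ "Abs_fin_seq (\<lambda>i. if i < d then a i else 0)"]) (auto simp: Rn_def)
  show ?thesis
  proof (rule ex_ex1I[OF *], unfold fin_seq_eq_iff, intro allI)
    fix x y i
    assume "x \<in> Rn d \<and> (\<forall>i<d. coord x i = a i)" "y \<in> Rn d \<and> (\<forall>i<d. coord y i = a i)"
    then show "coord x i = coord y i" by (cases "i < d") (auto simp: Rn_def)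
  qed
qed

text \<open>Everything below depends on a function \<open>f\<close> only through its restriction to \<open>Rn d\<close>.\<close>

definition grad :: "nat \<Rightarrow> (fin_seq \<Rightarrow> real) \<Rightarrow> fin_seq \<Rightarrow> fin_seq" where
  "grad d f x = (THE g. g \<in> Rn d \<and> (f has_derivative (\<lambda>h. inner h g)) (at x within Rn d))"

lemma has_derivative_Rn_unique:
  assumes f: "(f has_derivative F) (at x within Rn d)" and g: "(f has_derivative G) (at x within Rn d)"
    and x: "x \<in> Rn d" and h: "h \<in> Rn d"
  shows "F h = G h"
proof -
  define c where "c = (\<lambda>t::real. x + t *\<^sub>R h)"
  have c: "(c has_derivative (\<lambda>t. t *\<^sub>R h)) (at 0)"
    unfolding c_def by (auto intro!: derivative_eq_intros)
  have sub: "range c \<subseteq> Rn d"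
    using x h by (auto simp: c_def Rn_def)
  have "((\<lambda>t. f (c t)) has_derivative (\<lambda>t. F (t *\<^sub>R h))) (at 0)"
    by (rule has_derivative_in_compose[OF c])
      (use f sub in \<open>auto simp: c_def intro: has_derivative_subset\<close>)
  moreover have "((\<lambda>t. f (c t)) has_derivative (\<lambda>t. G (t *\<^sub>R h))) (at 0)"
    by (rule has_derivative_in_compose[OF c])
      (use g sub in \<open>auto simp: c_def intro: has_derivative_subset\<close>)
  ultimately have "(\<lambda>t. F (t *\<^sub>R h)) = (\<lambda>t. G (t *\<^sub>R h))"
    by (rule has_derivative_unique)
  then show ?thesis
    by (metis scaleR_one)
qed

lemma grad_unique:
  assumes "(f has_derivative (\<lambda>h. inner h g)) (at x within Rn d)" "g \<in> Rn d" "x \<in> Rn d"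
  shows "grad d f x = g"
  unfolding grad_def
proof (rule the_equality)
  fix g' assume g': "g' \<in> Rn d \<and> (f has_derivative (\<lambda>h. inner h g')) (at x within Rn d)"
  have diff: "g' - g \<in> Rn d"
    using g' assms(2) by (simp add: subspace_Rn subspace_diff)
  have "inner (g' - g) g' = inner (g' - g) g"
    by (rule has_derivative_Rn_unique[OF _ assms(1) assms(3) diff]) (use g' in simp)
  then have "inner (g' - g) (g' - g) = 0"
    by (simp add: inner_diff_right)
  then show "g' = g" by simp
qed (use assms in simp)

lemma grad_has_derivative:
  assumes "f differentiable (at x within Rn d)" "x \<in> Rn d"
  shows "grad d f x \<in> Rn d" "(f has_derivative (\<lambda>h. inner h (grad d f x))) (at x within Rn d)"
proof -
  from assms(1) obtain F where F: "(f has_derivative F) (at x within Rn d)"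
    by (auto simp: differentiable_def)
  interpret F: bounded_linear F
    using F by (rule has_derivative_bounded_linear)
  define e where "e j = (THE y. y \<in> Rn d \<and> (\<forall>i<d. coord y i = (if i = j then 1 else 0)))" for j
  have e: "e j \<in> Rn d \<and> (\<forall>i<d. coord (e j) i = (if i = j then 1 else 0))" for j
    unfolding e_def by (rule theI') (rule Rn_ex1_coord)
  define g where "g = (THE y. y \<in> Rn d \<and> (\<forall>i<d. coord y i = F (e i)))"
  have g: "g \<in> Rn d \<and> (\<forall>i<d. coord g i = F (e i))"
    unfolding g_def by (rule theI') (rule Rn_ex1_coord)
  have Fg: "F h = inner h g" if h: "h \<in> Rn d" for h
  proof -
    have "h = (\<Sum>j<d. coord h j *\<^sub>R e j)"
    proof (unfold fin_seq_eq_iff, intro allI)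
      fix i show "coord h i = coord (\<Sum>j<d. coord h j *\<^sub>R e j) i"
      proof (cases "i < d")
        case True
        have "coord (\<Sum>j<d. coord h j *\<^sub>R e j) i = (\<Sum>j<d. if i = j then coord h j else 0)"
          unfolding coord_sum by (rule sum.cong) (use True e in auto)
        then show ?thesis using True by simp
      next
        case False
        then show ?thesis using h e by (simp add: Rn_def)
      qed
    qed
    then have "F h = F (\<Sum>j<d. coord h j *\<^sub>R e j)" by (rule arg_cong)
    also have "\<dots> = (\<Sum>j<d. coord h j * F (e j))" by (simp add: F.sum F.scaleR)
    also have "\<dots> = inner h g" by (simp add: inner_Rn[OF h] g)
    finally show ?thesis .
  qed
  have "(f has_derivative (\<lambda>h. inner h g)) (at x within Rn d)"
    unfolding has_derivative_within
  proof
    show "bounded_linear (\<lambda>h. inner h g)" by (rule bounded_linear_inner_left)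
    have "((\<lambda>y. (1 / norm (y - x)) *\<^sub>R (f y - (f x + F (y - x)))) \<longlongrightarrow> 0) (at x within Rn d)"
      using F by (simp add: has_derivative_within)
    then show "((\<lambda>y. (1 / norm (y - x)) *\<^sub>R (f y - (f x + inner (y - x) g))) \<longlongrightarrow> 0) (at x within Rn d)"
      by (rule Lim_transform_eventually)
        (auto simp: eventually_at_filter Fg assms(2) subspace_Rn subspace_diff)
  qed
  moreover from this have "grad d f x = g"
    using g assms(2) by (blast intro: grad_unique)
  ultimately show "grad d f x \<in> Rn d" "(f has_derivative (\<lambda>h. inner h (grad d f x))) (at x within Rn d)"
    using g by simp_all
qed

definition smooth_convex :: "real \<Rightarrow> nat \<Rightarrow> (fin_seq \<Rightarrow> real) set" where
  "smooth_convex L d = {f. convex_on (Rn d) f \<and> f differentiable_on Rn d \<and>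
     L-lipschitz_on (Rn d) (grad d f) \<and> (\<exists>xm\<in>Rn d. \<forall>y\<in>Rn d. f xm \<le> f y)}"

text \<open>For \<open>f\<close> in \<open>smooth_convex L d\<close> the infimum is attained, so this is \<open>min f\<close>.\<close>

definition min_val :: "nat \<Rightarrow> (fin_seq \<Rightarrow> real) \<Rightarrow> real" where
  "min_val d f = (INF x\<in>Rn d. f x)"

text \<open>
  A method is its coefficient array \<open>\<beta> i k\<close>, of which only the entries with \<open>i < k\<close> are used;
  \<open>lin_span_iter \<beta> L G x0 k\<close> is the \<open>k\<close>-th iterate when \<open>G\<close> is the gradient map.
\<close>

fun lin_span_iter ::
  "(nat \<Rightarrow> nat \<Rightarrow> real) \<Rightarrow> real \<Rightarrow> (fin_seq \<Rightarrow> fin_seq) \<Rightarrow> fin_seq \<Rightarrow> nat \<Rightarrow> fin_seq" where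
  "lin_span_iter \<beta> L G x0 k =
     x0 - (1 / L) *\<^sub>R (\<Sum>i<k. \<beta> i k *\<^sub>R G (lin_span_iter \<beta> L G x0 i))"

declare lin_span_iter.simps [simp del]

text \<open>The supremum is taken in the extended reals, so that an unbounded ratio would give \<open>\<infinity>\<close>.\<close>

definition worst_case :: "(nat \<Rightarrow> nat \<Rightarrow> real) \<Rightarrow> real \<Rightarrow> nat \<Rightarrow> ereal" where
  "worst_case \<beta> L N = Sup {ereal ((norm (grad d f (lin_span_iter \<beta> L (grad d f) x0 N)))\<^sup>2
       / (L * (f x0 - min_val d f))) | d f x0.
     d \<ge> 1 \<and> f \<in> smooth_convex L d \<and> x0 \<in> Rn d \<and> f x0 > min_val d f}"

definition lower_density :: "nat set \<Rightarrow> ereal" where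
  "lower_density S = liminf (\<lambda>M. ereal (real (card (S \<inter> {1..M})) / real M))"

end

theory Submission
  imports Defs "HOL-Library.Discrete_Functions"
begin

text \<open>
  For a known horizon \<open>T\<close> an OGM-G type method has squared final gradient norm at most
  \<open>42 L (f x\<^sub>0 - f\<^sub>*) / T\<^sup>2\<close>.  In the dyadic block \<open>[2\<^sup>j, 2\<^sup>j\<^sup>+\<^sup>1)\<close> it is restarted from \<open>x\<^sub>0\<close> with a horizon
  \<open>T\<^sub>j\<close> of order \<open>2\<^sup>j / sqrt (\<omega> (2\<^sup>j))\<close>, and its output is repeated for the rest of the block.
  As \<open>\<omega>\<close> is unbounded, the steps spent on the restarts have density zero, and at all other \<open>N\<close>
  the bound \<open>42 / T\<^sub>j\<^sup>2\<close> is at most \<open>\<omega> N / N\<^sup>2\<close>.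
\<close>

section \<open>Smooth convex functions\<close>

context
  fixes L :: real and d :: nat and f :: "fin_seq \<Rightarrow> real"
  assumes L: "L > 0" and f: "f \<in> smooth_convex L d"
begin

lemma smooth_convex_grad:
  assumes "x \<in> Rn d"
  shows "grad d f x \<in> Rn d" "(f has_derivative (\<lambda>h. inner h (grad d f x))) (at x within Rn d)"
  using grad_has_derivative[of f x d] f assms
  by (auto simp: smooth_convex_def differentiable_on_def)

lemma has_real_derivative_line:
  assumes "x \<in> Rn d" "h \<in> Rn d"
  shows "((\<lambda>t. f (x + t *\<^sub>R h)) has_real_derivative inner h (grad d f (x + t *\<^sub>R h))) (at t)"
proof -
  have sub: "range (\<lambda>t. x + t *\<^sub>R h) \<subseteq> Rn d"
    using assms by (auto simp: Rn_def)
  have c: "((\<lambda>t. x + t *\<^sub>R h) has_derivative (\<lambda>t. t *\<^sub>R h)) (at t)"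
    by (auto intro!: derivative_eq_intros)
  have "x + t *\<^sub>R h \<in> Rn d"
    using sub by blast
  then have "(f has_derivative (\<lambda>k. inner k (grad d f (x + t *\<^sub>R h))))
      (at (x + t *\<^sub>R h) within range (\<lambda>t. x + t *\<^sub>R h))"
    by (rule has_derivative_subset[OF smooth_convex_grad(2) sub])
  then have "((\<lambda>t. f (x + t *\<^sub>R h)) has_derivative
      (\<lambda>s. inner (s *\<^sub>R h) (grad d f (x + t *\<^sub>R h)))) (at t)"
    by (rule has_derivative_in_compose[OF c])
  then show ?thesis
    by (simp add: has_field_derivative_def mult.commute[of _ "inner h _"])
qed

lemma smooth_convex_above_tangent:
  assumes "x \<in> Rn d" "y \<in> Rn d"
  shows "f y \<ge> f x + inner (grad d f x) (y - x)"
proof -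
  have h: "y - x \<in> Rn d"
    using assms by (simp add: subspace_Rn subspace_diff)
  have line: "x + t *\<^sub>R (y - x) \<in> Rn d" for t
    using assms by (auto simp: Rn_def)
  have "convex_on UNIV (\<lambda>t. f (x + t *\<^sub>R (y - x)))"
  proof (rule convex_onI)
    fix t s r :: real
    assume t: "0 < t" "t < 1"
    have "f (x + ((1 - t) *\<^sub>R s + t *\<^sub>R r) *\<^sub>R (y - x))
        = f ((1 - t) *\<^sub>R (x + s *\<^sub>R (y - x)) + t *\<^sub>R (x + r *\<^sub>R (y - x)))"
      by (simp add: algebra_simps)
    also have "\<dots> \<le> (1 - t) * f (x + s *\<^sub>R (y - x)) + t * f (x + r *\<^sub>R (y - x))"
      using f t line by (intro convex_onD[where A = "Rn d"]) (auto simp: smooth_convex_def)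
    finally show "f (x + ((1 - t) *\<^sub>R s + t *\<^sub>R r) *\<^sub>R (y - x))
        \<le> (1 - t) * f (x + s *\<^sub>R (y - x)) + t * f (x + r *\<^sub>R (y - x))" .
  qed simp
  then have "f (x + 1 *\<^sub>R (y - x)) - f (x + 0 *\<^sub>R (y - x))
      \<ge> inner (y - x) (grad d f (x + 0 *\<^sub>R (y - x))) * (1 - 0)"
    by (rule convex_on_imp_above_tangent)
      (use has_real_derivative_line[OF assms(1) h, of 0] in auto)
  then show ?thesis
    by (simp add: inner_commute)
qed

lemma descent_lemma:
  assumes "x \<in> Rn d" "h \<in> Rn d"
  shows "f (x + h) \<le> f x + inner (grad d f x) h + L / 2 * (norm h)\<^sup>2"
proof -
  \<comment> \<open>Restricted to the segment, the claim is \<open>q 1 \<le> q 0\<close>. The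
    Lipschitz bound on the gradient makes the derivative of \<open>q\<close> nonpositive.\<close>
  define q where "q t = f (x + t *\<^sub>R h) - t * inner (grad d f x) h - L / 2 * t\<^sup>2 * (norm h)\<^sup>2" for t
  have "q 1 \<le> q 0"
  proof (rule DERIV_nonpos_imp_nonincreasing[where f = q])
    fix t :: real
    assume t: "0 \<le> t" "t \<le> 1"
    define D where
      "D = inner h (grad d f (x + t *\<^sub>R h)) - inner (grad d f x) h - L * t * (norm h)\<^sup>2"
    have "(q has_real_derivative D) (at t)"
      unfolding q_def D_def
      by (auto intro!: derivative_eq_intros has_real_derivative_line assms)
    moreover have "D \<le> 0"
    proof -
      have "x + t *\<^sub>R h \<in> Rn d"
        using assms by (auto simp: Rn_def)
      moreover have "L-lipschitz_on (Rn d) (grad d f)"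
        using f by (simp add: smooth_convex_def)
      ultimately have "norm (grad d f (x + t *\<^sub>R h) - grad d f x) \<le> L * norm (t *\<^sub>R h)"
        using assms(1) by (force dest: lipschitz_onD simp: dist_norm)
      then have "norm h * norm (grad d f (x + t *\<^sub>R h) - grad d f x) \<le> norm h * (L * norm (t *\<^sub>R h))"
        by (intro mult_left_mono) auto
      moreover have "inner h (grad d f (x + t *\<^sub>R h) - grad d f x)
          \<le> norm h * norm (grad d f (x + t *\<^sub>R h) - grad d f x)"
        by (rule norm_cauchy_schwarz)
      ultimately show ?thesis
        using t by (simp add: D_def inner_diff_right inner_commute power2_eq_square algebra_simps)
    qed
    ultimately show "\<exists>y. (q has_real_derivative y) (at t) \<and> y \<le> 0"
      by blast
  qed simp
  then show ?thesis
    by (simp add: q_def)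
qed

text \<open>Evaluate \<open>f\<close> at \<open>y + h\<close>: the tangent at \<open>x\<close>
  bounds it below and the descent lemma from \<open>y\<close> bounds it above. The choice
  \<open>h = - u / L\<close> minimises the resulting quadratic
  \<open>inner u h + L / 2 * (norm h)\<^sup>2\<close>.\<close>

lemma grad_cocoercive:
  assumes "x \<in> Rn d" "y \<in> Rn d"
  shows "f y \<ge> f x + inner (grad d f x) (y - x) + (norm (grad d f y - grad d f x))\<^sup>2 / (2 * L)"
proof -
  define u where "u = grad d f y - grad d f x"
  define h where "h = - (1 / L) *\<^sub>R u"
  have h: "h \<in> Rn d"
    unfolding h_def u_def using assms smooth_convex_grad(1)
    by (intro subspace_scale subspace_diff subspace_Rn)
  have "f x + inner (grad d f x) (y + h - x) \<le> f (y + h)"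
    using assms h by (intro smooth_convex_above_tangent subspace_add subspace_Rn)
  also have "\<dots> \<le> f y + inner (grad d f y) h + L / 2 * (norm h)\<^sup>2"
    by (rule descent_lemma[OF assms(2) h])
  finally have "f x + inner (grad d f x) (y - x) \<le> f y + inner u h + L / 2 * (norm h)\<^sup>2"
    by (simp add: u_def inner_diff_left inner_diff_right inner_add_right)
  moreover have "inner u h + L / 2 * (norm h)\<^sup>2 = - (norm u)\<^sup>2 / (2 * L)"
    using L unfolding h_def power2_norm_eq_inner by (simp add: field_simps)
  ultimately show ?thesis
    unfolding u_def[symmetric] by linarith
qed

lemma min_val_le:
  assumes "x \<in> Rn d"
  shows "min_val d f \<le> f x - (norm (grad d f x))\<^sup>2 / (2 * L)"
proof -
  have h: "- (1 / L) *\<^sub>R grad d f x \<in> Rn d"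
    using assms smooth_convex_grad(1) by (intro subspace_scale subspace_Rn)
  \<comment> \<open>The minimizer supplies the lower bound without which the real infimum need not
    lie below the values.\<close>
  obtain xm where "\<And>y. y \<in> Rn d \<Longrightarrow> f xm \<le> f y"
    using f by (auto simp: smooth_convex_def)
  then have "bdd_below (f ` Rn d)"
    by (rule bdd_belowI2)
  then have "min_val d f \<le> f (x + - (1 / L) *\<^sub>R grad d f x)"
    unfolding min_val_def using assms h by (intro cINF_lower subspace_add subspace_Rn)
  also have "\<dots> \<le> f x - (norm (grad d f x))\<^sup>2 / (2 * L)"
    using descent_lemma[OF assms h] L unfolding power2_norm_eq_inner by (simp add: field_simps)
  finally show ?thesis .
qed

end


section \<open>A method for a fixed horizon\<close>

text \<open>
  The weights are rational functions of the number \<open>n = N - k\<close> of remaining steps.  \<open>ogm_A\<close> is the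
  multiplier of the cocoercivity inequality between consecutive iterates, its increment \<open>ogm_a\<close>
  that of the one between \<open>x\<^sub>N\<close> and \<open>x\<^sub>k\<close>, and \<open>ogm_v\<close> is determined by cancelling
  the cross terms (\<open>ogm_cross_coeff\<close>).  The subtraction is real, so \<open>ogm_v N (N + 1) = 0\<close>.
\<close>

definition ogm_A :: "nat \<Rightarrow> nat \<Rightarrow> real" where
  "ogm_A N k = (let n = real N - real k in 1 / ((n + 6) * (n + 7)))"

definition ogm_a :: "nat \<Rightarrow> nat \<Rightarrow> real" where
  "ogm_a N k = (let n = real N - real k in 2 / ((n + 5) * (n + 6) * (n + 7)))"

definition ogm_v :: "nat \<Rightarrow> nat \<Rightarrow> real" where
  "ogm_v N k = (let n = real N - real k in (n + 1) * (n + 6) * (n + 7) * (n + 8) / 8)"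

lemma ogm_a_eq: "k \<le> N \<Longrightarrow> ogm_a N k = ogm_A N (Suc k) - ogm_A N k"
proof -
  assume "k \<le> N"
  define n where "n = real N - real k"
  have "n \<ge> 0" using \<open>k \<le> N\<close> by (simp add: n_def)
  have "real N - real (Suc k) = n - 1" by (simp add: n_def)
  then show ?thesis
    using \<open>n \<ge> 0\<close> unfolding ogm_a_def ogm_A_def n_def[symmetric] Let_def
    by (simp add: divide_simps) (simp add: algebra_simps)
qed

lemma ogm_cross_coeff:
  "k \<le> N \<Longrightarrow> ogm_A N k * (ogm_v N k - ogm_v N (Suc k)) = 1 + 2 * ogm_a N k * ogm_v N (Suc k)"
proof -
  assume "k \<le> N"
  define n where "n = real N - real k"
  have "n \<ge> 0" using \<open>k \<le> N\<close> by (simp add: n_def)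
  have "real N - real (Suc k) = n - 1" by (simp add: n_def)
  then show ?thesis
    using \<open>n \<ge> 0\<close> unfolding ogm_a_def ogm_A_def ogm_v_def n_def[symmetric] Let_def
    by (simp add: divide_simps) (simp add: algebra_simps)
qed

text \<open>The ratio of the two sides is \<open>n / (n + 5)\<close>. This absorbs the
  squared-gradient term of each step of the potential; the factor 2 serves the initial value, where
  only half of \<open>A 0 * (norm (G 0))\<^sup>2\<close> is available.\<close>

lemma ogm_diag_coeff: "k \<le> N \<Longrightarrow> 2 * (ogm_v N (Suc k) * (ogm_a N k)\<^sup>2) \<le> ogm_A N k"
proof -
  assume "k \<le> N"
  define n where "n = real N - real k"
  have "n \<ge> 0" using \<open>k \<le> N\<close> by (simp add: n_def)
  have "real N - real (Suc k) = n - 1" by (simp add: n_def)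
  then have "2 * (ogm_v N (Suc k) * (ogm_a N k)\<^sup>2) = (n / (n + 5)) * (1 / ((n + 6) * (n + 7)))"
    using \<open>n \<ge> 0\<close> unfolding ogm_a_def ogm_v_def n_def[symmetric] Let_def
    by (simp add: divide_simps power2_eq_square) (simp add: algebra_simps)
  also have "\<dots> \<le> 1 * (1 / ((n + 6) * (n + 7)))"
    using \<open>n \<ge> 0\<close> by (intro mult_right_mono) auto
  finally show ?thesis
    by (simp add: ogm_A_def n_def[symmetric] Let_def)
qed

lemma ogm_A_pos: "k \<le> N \<Longrightarrow> ogm_A N k > 0"
  by (simp add: ogm_A_def Let_def)

section \<open>The potential argument\<close>

text \<open>A weighted sum of cocoercivity inequalities, normalised to \<open>L = 1\<close>. The
  rate is the ratio \<open>A 0 / A N\<close> of the last and first weights, with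
  \<open>A N = 1 / 42\<close>.\<close>

lemma ogm_gradient_bound:
  fixes x G :: "nat \<Rightarrow> 'a :: real_inner" and F :: "nat \<Rightarrow> real"
  assumes "N > 0"
    and coco: "\<And>i j. i \<le> N \<Longrightarrow> j \<le> N \<Longrightarrow>
      F i \<ge> F j + inner (G j) (x i - x j) + (norm (G i - G j))\<^sup>2 / 2"
    and step: "\<And>m. m < N \<Longrightarrow> x (Suc m) = x m - G m
      - (ogm_v N (Suc m) - ogm_v N (Suc (Suc m))) *\<^sub>R (\<Sum>i<Suc m. ogm_a N i *\<^sub>R G i)"
  shows "(norm (G N))\<^sup>2 \<le> 42 / ((real N + 6) * (real N + 7)) * (F 0 - (F N - (norm (G N))\<^sup>2 / 2))"
proof -
  define A where "A = ogm_A N"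
  define v where "v = ogm_v N"
  define a where "a = ogm_a N"
  define Z where "Z m = (\<Sum>i<m. a i *\<^sub>R G i)" for m
  define D where "D k = (x k - G k) - (x N - G N)" for k
  define H where "H k = F k - (norm (G k))\<^sup>2 / 2" for k
  define P where "P k = A k * (H k - H N) - inner (Z k) (D k)" for k
  txt \<open>In terms of \<open>H\<close>, cocoercivity is the gradient inequality at the points \<open>x k - G k\<close>.\<close>
  have H: "H i \<ge> H j + inner (G j) (D i - D j)" if "i \<le> N" "j \<le> N" for i j
    using coco[OF that]
    by (simp add: H_def D_def power2_norm_eq_inner inner_diff_left inner_diff_right inner_add_right
        inner_commute diff_divide_distrib add_divide_distrib algebra_simps)
  have Z_Suc: "Z (Suc m) = Z m + a m *\<^sub>R G m" for m
    by (simp add: Z_def)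
  have D_diff: "D k - D (Suc k) = (v (Suc k) - v (Suc (Suc k))) *\<^sub>R Z (Suc k) + G (Suc k)"
    if "k < N" for k
    unfolding D_def step[OF that] v_def Z_def a_def by (simp add: algebra_simps)
  have a_eq: "a k = A (Suc k) - A k" if "k \<le> N" for k
    using ogm_a_eq[OF that] by (simp add: a_def A_def)
  have A_pos: "A k > 0" if "k \<le> N" for k
    using ogm_A_pos[OF that] by (simp add: A_def)
  have a_nonneg: "a k \<ge> 0" if "k \<le> N" for k
    using that by (simp add: a_def ogm_a_def Let_def)
  txt \<open>The potential \<open>P k + v (k + 1) |Z (k + 1)|\<^sup>2\<close> does not increase.\<close>
  have step_le: "P (Suc k) + v (Suc (Suc k)) * (norm (Z (Suc (Suc k))))\<^sup>2
      \<le> P k + v (Suc k) * (norm (Z (Suc k)))\<^sup>2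
        + (v (Suc (Suc k)) * (a (Suc k))\<^sup>2 - A (Suc k)) * (norm (G (Suc k)))\<^sup>2"
    if k: "k < N" for k
  proof -
    have "A (Suc k) * (H k - H (Suc k) - inner (G (Suc k)) (D k - D (Suc k))) \<ge> 0"
      using H[of k "Suc k"] A_pos[of "Suc k"] k by simp
    moreover have "a k * (H N - H k + inner (G k) (D k)) \<ge> 0"
      using H[of N k] a_nonneg[of k] k by (simp add: D_def[of N])
    \<comment> \<open>Since \<open>A (Suc k) = A k + a k\<close>, the values in the two weighted
      inequalities combine to
      \<open>A k * (H k - H N) - A (Suc k) * (H (Suc k) - H N)\<close>.\<close>
    moreover have "P k - P (Suc k) =
        A (Suc k) * (H k - H (Suc k) - inner (G (Suc k)) (D k - D (Suc k)))
        + a k * (H N - H k + inner (G k) (D k))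
        - inner (Z (Suc k) - A (Suc k) *\<^sub>R G (Suc k)) (D k - D (Suc k))"
    proof -
      have "A (Suc k) = A k + a k"
        using a_eq[of k] k by simp
      then show ?thesis
        by (simp add: P_def Z_Suc[of k] algebra_simps)
    qed
    ultimately have "P (Suc k) \<le> P k + inner (Z (Suc k) - A (Suc k) *\<^sub>R G (Suc k)) (D k - D (Suc k))"
      by linarith
    also have "inner (Z (Suc k) - A (Suc k) *\<^sub>R G (Suc k)) (D k - D (Suc k))
      = (v (Suc k) - v (Suc (Suc k))) * (norm (Z (Suc k)))\<^sup>2 - A (Suc k) * (norm (G (Suc k)))\<^sup>2
        + (1 - A (Suc k) * (v (Suc k) - v (Suc (Suc k)))) * inner (Z (Suc k)) (G (Suc k))"
      unfolding D_diff[OF k]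
      by (simp add: power2_norm_eq_inner inner_commute[of "G (Suc k)" "Z (Suc k)"] algebra_simps)
    \<comment> \<open>This coefficient cancels the cross term in the expansion of \<open>v (Suc (Suc
      k)) * (norm (Z (Suc k) + a (Suc k) *\<^sub>R G (Suc k)))\<^sup>2\<close>.\<close>
    also have "1 - A (Suc k) * (v (Suc k) - v (Suc (Suc k))) = - 2 * a (Suc k) * v (Suc (Suc k))"
      using ogm_cross_coeff[of "Suc k" N] k by (simp add: A_def v_def a_def)
    finally show ?thesis
      unfolding Z_Suc[of "Suc k"] power2_norm_eq_inner
      by (simp add: inner_commute[of "G (Suc k)" "Z (Suc k)"] power2_eq_square algebra_simps)
  qed
  have diag: "2 * (v (Suc k) * (a k)\<^sup>2) \<le> A k" if "k \<le> N" for k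
    using ogm_diag_coeff[OF that] by (simp add: A_def v_def a_def)
  have mono: "P k + v (Suc k) * (norm (Z (Suc k)))\<^sup>2 \<le> P 0 + v 1 * (norm (Z 1))\<^sup>2"
    if "k \<le> N" for k
    using that
  proof (induction k)
    case (Suc k)
    have "(v (Suc (Suc k)) * (a (Suc k))\<^sup>2 - A (Suc k)) * (norm (G (Suc k)))\<^sup>2 \<le> 0"
      using diag[OF Suc.prems] A_pos[OF Suc.prems] by (intro mult_nonpos_nonneg) auto
    then show ?case
      using step_le[of k] Suc by simp
  qed simp
  have P0: "P 0 = A 0 * (H 0 - H N)" and PN: "P N = 0"
    by (simp_all add: P_def Z_def D_def)
  have v_end: "v (Suc N) = 0"
    by (simp add: v_def ogm_v_def Let_def)
  \<comment> \<open>This offsets the \<open>(norm (G 0))\<^sup>2 / 2\<close> subtracted in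
    \<open>H 0\<close>, so that \<open>F 0\<close> itself enters the bound.\<close>
  have init: "v 1 * (norm (Z 1))\<^sup>2 \<le> A 0 * (norm (G 0))\<^sup>2 / 2"
    using mult_right_mono[OF diag[of 0], of "(norm (G 0))\<^sup>2"]
    by (simp add: Z_def power_mult_distrib)
  \<comment> \<open>In the last step the diagonal term is kept: as \<open>P N\<close> and
    \<open>v (Suc N)\<close> vanish, it is the term \<open>- A N * (norm (G N))\<^sup>2\<close> that
    yields the left side.\<close>
  have "A N * (norm (G N))\<^sup>2 \<le> A 0 * (F 0 - H N)"
  proof -
    obtain k where Suc: "N = Suc k"
      using \<open>N > 0\<close> gr0_implies_Suc by blast
    have "A N * (norm (G N))\<^sup>2 \<le> P k + v (Suc k) * (norm (Z (Suc k)))\<^sup>2"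
      using step_le[of k] Suc v_end PN by simp
    also have "\<dots> \<le> A 0 * (H 0 - H N) + A 0 * (norm (G 0))\<^sup>2 / 2"
      using mono[of k] Suc P0 init by simp
    finally show ?thesis
      by (simp add: H_def algebra_simps)
  qed
  moreover have "A N = 1 / 42" "A 0 = 1 / ((real N + 6) * (real N + 7))"
    by (simp_all add: A_def ogm_A_def Let_def)
  ultimately show ?thesis
    by (simp add: H_def mult_ac)
qed

section \<open>The method as a coefficient array\<close>

text \<open>Unrolled form of the step recursion: \<open>G i\<close> enters with weight 1 in step
  \<open>i\<close>, and with weight \<open>ogm_a N i\<close> times an increment of
  \<open>ogm_v\<close> in each of the steps \<open>i\<close> to \<open>m - 1\<close>; these
  increments telescope.\<close>

definition ogm_coeff :: "nat \<Rightarrow> nat \<Rightarrow> nat \<Rightarrow> real" where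
  "ogm_coeff N i m = 1 + ogm_a N i * (ogm_v N (Suc i) - ogm_v N (Suc m))"

lemma ogm_coeff_step:
  fixes x G :: "nat \<Rightarrow> 'a :: real_vector"
  assumes "\<And>m. m \<le> N \<Longrightarrow> x m = x0 - (\<Sum>i<m. ogm_coeff N i m *\<^sub>R G i)" and "m < N"
  shows "x (Suc m) = x m - G m
      - (ogm_v N (Suc m) - ogm_v N (Suc (Suc m))) *\<^sub>R (\<Sum>i<Suc m. ogm_a N i *\<^sub>R G i)"
proof -
  define c where "c = ogm_v N (Suc m) - ogm_v N (Suc (Suc m))"
  have "ogm_coeff N i (Suc m) *\<^sub>R G i = ogm_coeff N i m *\<^sub>R G i + c *\<^sub>R ogm_a N i *\<^sub>R G i" for i
    by (simp add: ogm_coeff_def c_def algebra_simps)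
  then have "(\<Sum>i<Suc m. ogm_coeff N i (Suc m) *\<^sub>R G i)
      = (\<Sum>i<Suc m. ogm_coeff N i m *\<^sub>R G i) + c *\<^sub>R (\<Sum>i<Suc m. ogm_a N i *\<^sub>R G i)"
    by (simp add: sum.distrib scaleR_right.sum del: sum.lessThan_Suc)
  \<comment> \<open>The extra summand has coefficient \<open>ogm_coeff N m m = 1\<close>.\<close>
  moreover have "(\<Sum>i<Suc m. ogm_coeff N i m *\<^sub>R G i) = (\<Sum>i<m. ogm_coeff N i m *\<^sub>R G i) + G m"
    by (simp add: ogm_coeff_def)
  ultimately show ?thesis
    using assms(1)[of m] assms(1)[of "Suc m"] \<open>m < N\<close>
    by (simp add: c_def del: sum.lessThan_Suc)
qed

text \<open>Dividing gradients and values by \<open>L\<close> reduces to the normalised bound. The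
  iterates are an arbitrary sequence, so the result also applies to a shifted piece of a longer
  run.\<close>

lemma ogm_worst_case:
  assumes "N > 0" and L: "L > 0" and f: "f \<in> smooth_convex L d"
    and Rn: "\<And>m. m \<le> N \<Longrightarrow> x m \<in> Rn d"
    and x: "\<And>m. m \<le> N \<Longrightarrow> x m = x 0 - (1 / L) *\<^sub>R (\<Sum>i<m. ogm_coeff N i m *\<^sub>R grad d f (x i))"
  shows "(norm (grad d f (x N)))\<^sup>2
    \<le> 42 / ((real N + 6) * (real N + 7)) * (L * (f (x 0) - min_val d f))"
proof -
  define G where "G i = (1 / L) *\<^sub>R grad d f (x i)" for i
  define F where "F i = f (x i) / L" for i
  have norm_G: "(norm (G i))\<^sup>2 = (norm (grad d f (x i)))\<^sup>2 / L\<^sup>2" for i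
    by (simp add: G_def power_divide)
  have G_diff: "G i - G j = (1 / L) *\<^sub>R (grad d f (x i) - grad d f (x j))" for i j
    by (simp add: G_def scaleR_diff_right)
  have x_G: "x m = x 0 - (\<Sum>i<m. ogm_coeff N i m *\<^sub>R G i)" if "m \<le> N" for m
  proof -
    have "(\<Sum>i<m. ogm_coeff N i m *\<^sub>R G i)
        = (1 / L) *\<^sub>R (\<Sum>i<m. ogm_coeff N i m *\<^sub>R grad d f (x i))"
      by (simp add: G_def scaleR_right.sum mult.commute)
    then show ?thesis
      using x[OF that] by (simp only:)
  qed
  have bound: "(norm (G N))\<^sup>2
    \<le> 42 / ((real N + 6) * (real N + 7)) * (F 0 - (F N - (norm (G N))\<^sup>2 / 2))"
  proof (rule ogm_gradient_bound[where x = x, OF \<open>N > 0\<close>])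
    fix i j
    assume "i \<le> N" "j \<le> N"
    then have "f (x j) + inner (grad d f (x j)) (x i - x j)
        + (norm (grad d f (x i) - grad d f (x j)))\<^sup>2 / (2 * L) \<le> f (x i)"
      by (intro grad_cocoercive[OF L f] Rn)
    then have "(f (x j) + inner (grad d f (x j)) (x i - x j)
        + (norm (grad d f (x i) - grad d f (x j)))\<^sup>2 / (2 * L)) / L \<le> f (x i) / L"
      using L by (intro divide_right_mono) auto
    then show "F j + inner (G j) (x i - x j) + (norm (G i - G j))\<^sup>2 / 2 \<le> F i"
      unfolding G_diff
      by (simp add: F_def G_def add_divide_distrib power_divide power2_eq_square mult_ac)
  next
    fix m
    assume "m < N"
    show "x (Suc m) = x m - G m
      - (ogm_v N (Suc m) - ogm_v N (Suc (Suc m))) *\<^sub>R (\<Sum>i<Suc m. ogm_a N i *\<^sub>R G i)"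
      by (rule ogm_coeff_step[where ?x0.0 = "x 0"]) (erule x_G, rule \<open>m < N\<close>)
  qed
  \<comment> \<open>The quantity subtracted from \<open>F 0\<close> in the bound is the guaranteed
    value after one more gradient step, hence at least the scaled minimum.\<close>
  have "min_val d f \<le> f (x N) - (norm (grad d f (x N)))\<^sup>2 / (2 * L)"
    by (rule min_val_le[OF L f Rn]) simp
  then have "min_val d f / L \<le> (f (x N) - (norm (grad d f (x N)))\<^sup>2 / (2 * L)) / L"
    using L by (intro divide_right_mono) auto
  then have "F 0 - (F N - (norm (G N))\<^sup>2 / 2) \<le> (f (x 0) - min_val d f) / L"
    unfolding norm_G by (simp add: F_def diff_divide_distrib power2_eq_square)
  then have "42 / ((real N + 6) * (real N + 7)) * (F 0 - (F N - (norm (G N))\<^sup>2 / 2))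
      \<le> 42 / ((real N + 6) * (real N + 7)) * ((f (x 0) - min_val d f) / L)"
    by (intro mult_left_mono) auto
  with bound have "(norm (grad d f (x N)))\<^sup>2 / L\<^sup>2
      \<le> 42 / ((real N + 6) * (real N + 7)) * ((f (x 0) - min_val d f) / L)"
    unfolding norm_G by (rule order_trans)
  then have "(norm (grad d f (x N)))\<^sup>2 / L\<^sup>2 * L\<^sup>2
      \<le> 42 / ((real N + 6) * (real N + 7)) * ((f (x 0) - min_val d f) / L) * L\<^sup>2"
    by (intro mult_right_mono) auto
  then show ?thesis
    using L by (simp add: power2_eq_square mult_ac)
qed


section \<open>Dyadic restarts\<close>

text \<open>
  For \<open>2 ^ j \<le> k < 2 ^ (j + 1)\<close> the first \<open>T j\<close> steps run the method with horizon \<open>T j\<close> from the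
  initial point (index \<open>2 ^ j\<close> is the initial point again); afterwards its output is repeated.
\<close>

definition restart_coeff :: "(nat \<Rightarrow> nat) \<Rightarrow> nat \<Rightarrow> nat \<Rightarrow> real" where
  "restart_coeff T i k = (let j = floor_log k; m = min (k - 2 ^ j) (T j) in
     if 2 ^ j \<le> i \<and> i < 2 ^ j + m then ogm_coeff (T j) (i - 2 ^ j) m else 0)"

text \<open>The horizons at which the run of the current block is complete; a block with
  \<open>T j \<ge> 2 ^ j\<close> contributes none.\<close>

definition restart_good :: "(nat \<Rightarrow> nat) \<Rightarrow> nat set" where
  "restart_good T = {N. N \<ge> 1 \<and> N \<ge> 2 ^ floor_log N + T (floor_log N)}"

lemma floor_log_pow2_add:
  assumes "m < 2 ^ j"
  shows "floor_log (2 ^ j + m) = j"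
  using assms by (intro floor_log_eqI) auto

text \<open>All weights on gradients before index \<open>2 ^ j\<close> vanish, so earlier blocks are
  forgotten and the sum can be shifted by \<open>2 ^ j\<close>. The hypothesis on \<open>m\<close>
  keeps the index inside block \<open>j\<close>.\<close>

lemma restart_iter:
  fixes G :: "fin_seq \<Rightarrow> fin_seq" and x0 :: fin_seq and L :: real
  assumes k: "2 ^ j + m < 2 ^ Suc j" and m: "m' = min m (T j)"
  defines "x \<equiv> lin_span_iter (restart_coeff T) L G x0"
  shows "x (2 ^ j + m) = x0 - (1 / L) *\<^sub>R (\<Sum>i<m'. ogm_coeff (T j) i m' *\<^sub>R G (x (2 ^ j + i)))"
proof -
  have fl: "floor_log (2 ^ j + m) = j"
    using k by (intro floor_log_pow2_add) simp
  have "(\<Sum>i<2 ^ j + m. restart_coeff T i (2 ^ j + m) *\<^sub>R G (x i))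
      = (\<Sum>i\<in>{2 ^ j..<2 ^ j + m'}. restart_coeff T i (2 ^ j + m) *\<^sub>R G (x i))"
    by (rule sum.mono_neutral_right) (auto simp: restart_coeff_def Let_def fl m)
  also have "\<dots> = (\<Sum>i<m'. ogm_coeff (T j) i m' *\<^sub>R G (x (2 ^ j + i)))"
    by (rule sum.reindex_bij_witness[of _ "\<lambda>i. 2 ^ j + i" "\<lambda>i. i - 2 ^ j"])
      (auto simp: restart_coeff_def Let_def fl m)
  finally show ?thesis
    unfolding x_def by (subst lin_span_iter.simps) simp
qed

lemma lin_span_iter_Rn:
  assumes "\<And>x. x \<in> Rn d \<Longrightarrow> G x \<in> Rn d" "x0 \<in> Rn d"
  shows "lin_span_iter \<beta> L G x0 k \<in> Rn d"
proof (induction k rule: less_induct)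
  case (less k)
  then show ?case
    by (subst lin_span_iter.simps)
      (auto intro!: subspace_diff subspace_scale subspace_sum subspace_Rn assms)
qed

lemma restart_worst_case:
  assumes L: "L > 0" and N: "N \<in> restart_good T" and T: "T (floor_log N) > 0"
  shows "worst_case (restart_coeff T) L N
    \<le> ereal (42 / ((real (T (floor_log N)) + 6) * (real (T (floor_log N)) + 7)))"
  unfolding worst_case_def
proof (rule Sup_least, clarify)
  fix d f x0
  assume f: "f \<in> smooth_convex L d" and x0: "x0 \<in> Rn d" and gap: "min_val d f < f x0"
  define j where "j = floor_log N"
  define G where "G = grad d f"
  define x where "x = lin_span_iter (restart_coeff T) L G x0"
  have "N \<ge> 1" and NT: "2 ^ j + T j \<le> N"
    using N by (auto simp: restart_good_def j_def)
  have Nlt: "N < 2 ^ Suc j"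
    unfolding j_def using \<open>N \<ge> 1\<close> floor_log_exp2_gt[of N] by simp
  have x_Rn: "x (2 ^ j + m) \<in> Rn d" for m
    unfolding x_def G_def by (rule lin_span_iter_Rn[OF smooth_convex_grad(1)[OF L f] x0])
  have start: "x (2 ^ j + 0) = x0"
    using restart_iter[where j = j and m = 0 and m' = 0 and T = T and L = L and G = G and ?x0.0 = x0]
    by (simp add: x_def)
  have x_eq: "x (2 ^ j + m) = x (2 ^ j + 0)
      - (1 / L) *\<^sub>R (\<Sum>i<m. ogm_coeff (T j) i m *\<^sub>R grad d f (x (2 ^ j + i)))"
    if "m \<le> T j" for m
    using restart_iter[where j = j and m = m and m' = m and T = T and L = L and G = G and ?x0.0 = x0]
      start that NT Nlt
    by (simp add: x_def G_def)
  have "(norm (grad d f (x (2 ^ j + T j))))\<^sup>2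
      \<le> 42 / ((real (T j) + 6) * (real (T j) + 7)) * (L * (f (x (2 ^ j + 0)) - min_val d f))"
    proof (rule ogm_worst_case[OF _ L f, where x = "\<lambda>m. x (2 ^ j + m)"])
    show "T j > 0"
      using T by (simp add: j_def)
  qed (rule x_Rn, erule x_eq)
  \<comment> \<open>At both indices the step count is capped at \<open>T j\<close>, so the same
    combination of gradients is used.\<close>
  moreover have "x N = x (2 ^ j + T j)"
    using restart_iter[where j = j and m = "N - 2 ^ j" and m' = "T j" and T = T and L = L
        and G = G and ?x0.0 = x0]
      restart_iter[where j = j and m = "T j" and m' = "T j" and T = T and L = L
        and G = G and ?x0.0 = x0] NT Nlt
    by (simp add: x_def)
  ultimately have "(norm (grad d f (x N)))\<^sup>2
      \<le> 42 / ((real (T j) + 6) * (real (T j) + 7)) * (L * (f x0 - min_val d f))"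
    using start by simp
  moreover have "L * (f x0 - min_val d f) > 0"
    using L gap by simp
  ultimately show "ereal ((norm (grad d f (lin_span_iter (restart_coeff T) L (grad d f) x0 N)))\<^sup>2
       / (L * (f x0 - min_val d f)))
    \<le> ereal (42 / ((real (T (floor_log N)) + 6) * (real (T (floor_log N)) + 7)))"
    by (simp add: x_def G_def j_def pos_divide_le_eq)
qed

section \<open>Density of the good horizons\<close>

text \<open>Block \<open>j\<close> has at most \<open>T j\<close> bad horizons. As
  \<open>T j\<close> is small against \<open>2 ^ j\<close>, their geometric-type sum up to the block
  of \<open>M\<close> is small against \<open>M\<close>.\<close>

lemma restart_good_density:
  assumes T: "(\<lambda>j. real (T j) / 2 ^ j) \<longlonglongrightarrow> 0"
  shows "lower_density (restart_good T) = 1"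
proof -
  define S where "S = restart_good T"
  have bad: "card ({1..M} - S) \<le> (\<Sum>j\<le>floor_log M. T j)" for M
  proof -
    have "{1..M} - S \<subseteq> (\<Union>j\<le>floor_log M. {2 ^ j..<2 ^ j + T j})"
    proof
      fix k
      assume k: "k \<in> {1..M} - S"
      then have "floor_log k \<le> floor_log M" "2 ^ floor_log k \<le> k"
        by (auto intro: floor_log_le_iff floor_log_exp2_le)
      with k show "k \<in> (\<Union>j\<le>floor_log M. {2 ^ j..<2 ^ j + T j})"
        by (auto simp: S_def restart_good_def not_le)
    qed
    then have "card ({1..M} - S) \<le> card (\<Union>j\<le>floor_log M. {2 ^ j..<2 ^ j + T j})"
      by (intro card_mono) auto
    also have "\<dots> \<le> (\<Sum>j\<le>floor_log M. card {2 ^ j..<2 ^ j + T j})"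
      by (rule card_UN_le) simp
    finally show ?thesis by simp
  qed
  have "(\<lambda>M. real (card ({1..M} - S)) / real M) \<longlonglongrightarrow> 0"
  proof (rule LIMSEQ_I)
    fix r :: real
    assume "r > 0"
    define e where "e = r / 4"
    have "e > 0" using \<open>r > 0\<close> by (simp add: e_def)
    obtain j0 where j0: "\<And>j. j \<ge> j0 \<Longrightarrow> real (T j) / 2 ^ j < e"
      using LIMSEQ_D[OF T \<open>e > 0\<close>] by auto
    \<comment> \<open>\<open>C\<close> pays for the finitely many blocks before
      \<open>T j < e * 2 ^ j\<close> sets in; the later ones add at most
      \<open>2 * e * 2 ^ J\<close>, because
      \<open>2 * e * 2 ^ J + e * 2 ^ Suc J = 2 * e * 2 ^ Suc J\<close>.\<close>
    define C where "C = (\<Sum>j<j0. real (T j))"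
    have "C \<ge> 0" by (simp add: C_def sum_nonneg)
    have sum_le: "(\<Sum>j\<le>J. real (T j)) \<le> C + 2 * e * 2 ^ J" for J
    proof (induction J)
      case 0
      show ?case
      proof (cases "j0 = 0")
        case True
        then show ?thesis using j0[of 0] \<open>e > 0\<close> \<open>C \<ge> 0\<close> by simp
      next
        case False
        then have "real (T 0) \<le> C"
          unfolding C_def by (intro member_le_sum) auto
        then show ?thesis using \<open>e > 0\<close> by simp
      qed
    next
      case (Suc J)
      show ?case
      proof (cases "j0 \<le> Suc J")
        case True
        then show ?thesis using Suc j0[OF True] by (simp add: field_simps)
      next
        case False
        then have "(\<Sum>j\<le>Suc J. real (T j)) \<le> C"
          unfolding C_def by (intro sum_mono2) auto
        moreover have "2 * e * 2 ^ Suc J \<ge> 0" using \<open>e > 0\<close> by simp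
        ultimately show ?thesis by linarith
      qed
    qed
    \<comment> \<open>Beyond \<open>M0\<close> also \<open>C < e * M\<close>, so fewer than
      \<open>3 * e * M\<close> horizons are bad, which \<open>e = r / 4\<close> keeps below
      \<open>r * M\<close>.\<close>
    obtain M0 where M0: "C / e < real M0"
      using reals_Archimedean2 by blast
    have "norm (real (card ({1..M} - S)) / real M - 0) < r" if "M \<ge> Suc M0" for M
    proof -
      have M: "M > 0" using that by simp
      have "C < e * real M"
        using M0 that \<open>e > 0\<close> by (auto simp: field_simps intro: less_le_trans)
      moreover have "real (2 ^ floor_log M) \<le> real M"
        using floor_log_exp2_le[OF M] by (rule of_nat_mono)
      then have "2 * e * 2 ^ floor_log M \<le> 2 * e * real M"
        using \<open>e > 0\<close> by (intro mult_left_mono) auto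
      moreover have "real (card ({1..M} - S)) \<le> C + 2 * e * 2 ^ floor_log M"
        using of_nat_mono[OF bad[of M], where 'a = real] sum_le[of "floor_log M"]
        by simp
      ultimately have "real (card ({1..M} - S)) < 3 * e * real M"
        by linarith
      also have "\<dots> < r * real M"
        using M \<open>r > 0\<close> by (simp add: e_def)
      finally show ?thesis
        using M by (simp add: pos_divide_less_eq)
    qed
    then show "\<exists>no. \<forall>M\<ge>no. norm (real (card ({1..M} - S)) / real M - 0) < r"
      by blast
  qed
  then have "(\<lambda>M. 1 - real (card ({1..M} - S)) / real M) \<longlonglongrightarrow> 1 - 0"
    by (intro tendsto_intros)
  \<comment> \<open>At \<open>M = 0\<close> both quotients are 0 by convention and the identity
    fails.\<close>
  moreover have "1 - real (card ({1..M} - S)) / real M = real (card (S \<inter> {1..M})) / real M"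
    if "M \<ge> 1" for M
  proof -
    have "card {1..M} = card ({1..M} \<inter> S) + card ({1..M} - S)"
      by (rule card_Int_Diff) simp
    then have "real M = real (card (S \<inter> {1..M})) + real (card ({1..M} - S))"
      by (simp add: Int_commute)
    then show ?thesis
      using that by (simp add: field_simps)
  qed
  ultimately have "(\<lambda>M. real (card (S \<inter> {1..M})) / real M) \<longlonglongrightarrow> 1"
    by (subst (asm) tendsto_cong[OF eventually_sequentiallyI[of 1]]) auto
  then have "(\<lambda>M. ereal (real (card (S \<inter> {1..M})) / real M)) \<longlonglongrightarrow> ereal 1"
    by simp
  then show ?thesis
    unfolding lower_density_def S_def[symmetric]
    by (metis lim_imp_Liminf one_ereal_def sequentially_bot)
qed

section \<open>Choice of the block horizons\<close>

theorem theorem6: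
  fixes L :: real and \<omega> :: "nat \<Rightarrow> real"
  assumes "L > 0"
    and "\<And>N. N \<ge> 1 \<Longrightarrow> \<omega> N \<ge> 1"
    and "mono_on {1..} \<omega>"
    and "filterlim \<omega> at_top sequentially"
  shows "\<exists>(\<beta> :: nat \<Rightarrow> nat \<Rightarrow> real) (S :: nat set).
           S \<subseteq> {1..} \<and> lower_density S = 1 \<and>
           (\<forall>N\<in>S. worst_case \<beta> L N \<le> ereal (\<omega> N / (real N)\<^sup>2))"
proof -
  \<comment> \<open>Here \<open>168 = 4 * 42\<close>: in block \<open>j\<close> one has
    \<open>N < 2 * 2 ^ j\<close>, so \<open>42 * N\<^sup>2\<close> is at most \<open>168 * (2 ^
    j)\<^sup>2 = \<omega> (2 ^ j) * (2 ^ j * t j)\<^sup>2\<close>. Using \<omega> at the start of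
    the block lets monotonicity pass to \<open>\<omega> N\<close>.\<close>
  define t where "t j = sqrt (168 / \<omega> (2 ^ j))" for j :: nat
  define T where "T j = nat \<lceil>2 ^ j * t j\<rceil>" for j :: nat
  have \<omega>_pos: "\<omega> (2 ^ j) > 0" for j :: nat
    using assms(2)[of "2 ^ j"] by simp
  have t_pos: "t j > 0" for j
    using \<omega>_pos[of j] by (simp add: t_def)
  then have t_nonneg: "t j \<ge> 0" for j
    by (rule less_imp_le)
  have T_ge: "2 ^ j * t j \<le> real (T j)" for j
    unfolding T_def by (rule real_nat_ceiling_ge)
  have T_pos: "T j > 0" for j
    using t_pos[of j] by (simp add: T_def)
  have T_le: "real (T j) \<le> 2 ^ j * t j + 1" for j
    using t_nonneg[of j] of_int_ceiling_le_add_one[of "2 ^ j * t j"] by (simp add: T_def)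
  have "(\<lambda>j. real (T j) / 2 ^ j) \<longlonglongrightarrow> 0"
  \<comment> \<open>The summand \<open>(1 / 2) ^ j\<close> accounts for rounding \<open>T j\<close>
    up.\<close>
  proof (rule tendsto_sandwich[where f = "\<lambda>_. 0" and h = "\<lambda>j. t j + (1 / 2) ^ j"])
    have "filterlim (\<lambda>j::nat. 2 ^ j :: nat) at_top sequentially"
      by (intro filterlim_subseq strict_monoI power_strict_increasing) auto
    then have "filterlim (\<lambda>j. \<omega> (2 ^ j)) at_top sequentially"
      by (rule filterlim_compose[OF assms(4)])
    then have "t \<longlonglongrightarrow> sqrt 0"
      unfolding t_def by (intro tendsto_real_sqrt tendsto_divide_0[OF tendsto_const]
          filterlim_at_top_imp_at_infinity)
    moreover have "(\<lambda>j. (1 / 2 :: real) ^ j) \<longlonglongrightarrow> 0"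
      by (rule LIMSEQ_power_zero) simp
    ultimately show "(\<lambda>j. t j + (1 / 2) ^ j) \<longlonglongrightarrow> 0"
      using tendsto_add by fastforce
    show "\<forall>\<^sub>F j in sequentially. real (T j) / 2 ^ j \<le> t j + (1 / 2) ^ j"
      using T_le by (simp add: field_simps)
  qed auto
  then have "lower_density (restart_good T) = 1"
    by (rule restart_good_density)
  moreover have "worst_case (restart_coeff T) L N \<le> ereal (\<omega> N / (real N)\<^sup>2)"
    if N: "N \<in> restart_good T" for N
  proof -
    define j where "j = floor_log N"
    have "N \<ge> 1" using N by (simp add: restart_good_def)
    have lo: "2 ^ j \<le> N" and hi: "N < 2 * 2 ^ j"
      using \<open>N \<ge> 1\<close> floor_log_exp2_le[of N] floor_log_exp2_gt[of N] by (simp_all add: j_def)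
    have "real N \<le> real (2 * 2 ^ j)"
      using hi by (intro of_nat_mono) simp
    then have "(real N)\<^sup>2 \<le> (2 * 2 ^ j)\<^sup>2"
      by (intro power_mono) auto
    then have "42 * (real N)\<^sup>2 \<le> \<omega> (2 ^ j) * (2 ^ j * t j)\<^sup>2"
      using \<omega>_pos[of j] by (simp add: t_def power_mult_distrib)
    also have "\<dots> \<le> \<omega> N * (2 ^ j * t j)\<^sup>2"
      using lo \<open>N \<ge> 1\<close> by (intro mult_right_mono monotone_onD[OF assms(3)]) auto
    also have "\<dots> \<le> \<omega> N * ((real (T j) + 6) * (real (T j) + 7))"
    proof (rule mult_left_mono)
      have "(2 ^ j * t j)\<^sup>2 \<le> (real (T j))\<^sup>2"
        using T_ge t_nonneg by (intro power_mono) auto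
      also have "\<dots> \<le> (real (T j) + 6) * (real (T j) + 7)"
        unfolding power2_eq_square by (intro mult_mono) auto
      finally show "(2 ^ j * t j)\<^sup>2 \<le> (real (T j) + 6) * (real (T j) + 7)" .
      show "\<omega> N \<ge> 0" using assms(2)[OF \<open>N \<ge> 1\<close>] by simp
    qed
    finally have "42 * (real N)\<^sup>2 \<le> \<omega> N * ((real (T j) + 6) * (real (T j) + 7))" .
    moreover have "(real (T j) + 6) * (real (T j) + 7) > 0" "(real N)\<^sup>2 > 0"
      using \<open>N \<ge> 1\<close> by simp_all
    ultimately have "42 / ((real (T j) + 6) * (real (T j) + 7)) \<le> \<omega> N / (real N)\<^sup>2"
      by (simp only: pos_divide_le_eq pos_le_divide_eq times_divide_eq_left)
    then show ?thesis
      using restart_worst_case[OF assms(1) N T_pos] by (auto simp: j_def intro: order_trans)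
  qed
  moreover have "restart_good T \<subseteq> {1..}"
    by (auto simp: restart_good_def)
  ultimately show ?thesis
    by blast
qed

end
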